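(* As formal power series in $x$ and $y$, $$\sum_{n\geq 1}\sum_{k=0}^{\lfloor n/2\rfloor} P(n,k)\,x^ny^k=\sum_{n\geq 1}x^n\prod_{k=1}^n (1+kxy),$$ where $P(n,k)$ is the number of partial matchings of $[n]$ with exactly $k$ arcs and no neighbor alignments.
   Context: Write $[n]=\{1,2,\ldots,n\}$. A partition $\pi$ of $[n]$ (set partition into nonempty blocks) is represented by a diagram with vertices $1,\ldots,n$: for each block $B=\{i_1<i_2<\cdots<i_m\}$ one draws the arcs $(i_1,i_2),(i_2,i_3),\ldots,(i_{m-1},i_m)$. A partial matching of $[n]$ is a partition of $[n]$ in which each block has at most two elements; its arcs are the pairs $(i,j)$, $i<j$, such that $\{i,j\}$ is a block. A neighbor alignment is a pair of arcs $(i_1,j_1),(i_2,j_2)$ with $i_1<j_1<i_2<j_2$ and $j_1+1=i_2$. *)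

theory Defs
  imports "HOL-Analysis.Analysis"
begin

text \<open>The arcs of the diagram of a partition join consecutive elements of a block.\<close>

definition arcs :: "nat set set \<Rightarrow> (nat \<times> nat) set" where
  "arcs \<pi> = {(i, j). \<exists>B\<in>\<pi>. i \<in> B \<and> j \<in> B \<and> i < j \<and> \<not> (\<exists>k\<in>B. i < k \<and> k < j)}"

definition partial_matching :: "nat \<Rightarrow> nat set set \<Rightarrow> bool" where
  "partial_matching n \<pi> \<longleftrightarrow> partition_on {1..n} \<pi> \<and> (\<forall>B\<in>\<pi>. card B \<le> 2)"

lemma arcs_partial_matching:
  assumes "partial_matching n \<pi>"
  shows "arcs \<pi> = {(i, j). i < j \<and> {i, j} \<in> \<pi>}"
proof -
  have "B = {i, j}" if "B \<in> \<pi>" "i \<in> B" "j \<in> B" "i < j" for B i j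
  proof -
    have "B \<subseteq> {1..n}" and "card B \<le> 2"
      using assms that(1) by (auto simp: partial_matching_def partition_on_def)
    then have "finite B" by (meson finite_atLeastAtMost finite_subset)
    moreover have "card {i, j} = 2" using that(4) by simp
    ultimately show ?thesis
      using card_seteq[of B "{i, j}"] that(2,3) \<open>card B \<le> 2\<close> by simp
  qed
  then have "arcs \<pi> \<subseteq> {(i, j). i < j \<and> {i, j} \<in> \<pi>}"
    unfolding arcs_def by blast
  moreover have "(i, j) \<in> arcs \<pi>" if "i < j" "{i, j} \<in> \<pi>" for i j
    unfolding arcs_def using that by (auto intro!: bexI[of _ "{i, j}"])
  ultimately show ?thesis by blast
qed

definition neighbor_alignment :: "(nat \<times> nat) \<Rightarrow> (nat \<times> nat) \<Rightarrow> bool" where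
  "neighbor_alignment a b \<longleftrightarrow>
     (case (a, b) of ((i1, j1), (i2, j2)) \<Rightarrow> i1 < j1 \<and> j1 < i2 \<and> i2 < j2 \<and> j1 + 1 = i2)"

definition has_neighbor_alignment :: "nat set set \<Rightarrow> bool" where
  "has_neighbor_alignment \<pi> \<longleftrightarrow> (\<exists>a\<in>arcs \<pi>. \<exists>b\<in>arcs \<pi>. neighbor_alignment a b)"

definition num_NA_free :: "nat \<Rightarrow> nat \<Rightarrow> nat" where
  "num_NA_free n k = card {\<pi>. partial_matching n \<pi> \<and> card (arcs \<pi>) = k \<and> \<not> has_neighbor_alignment \<pi>}"

text \<open>Power series in x and y over the integers are power series in x whose coefficients are
  power series in y. Infinite sums are taken in the library's x-adic topology on this ring.\<close>

abbreviation var_x :: "int fps fps" where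
  "var_x \<equiv> fps_X"

abbreviation var_y :: "int fps fps" where
  "var_y \<equiv> fps_const fps_X"

end

theory Submission
  imports Defs
begin

text \<open>In a matching of \<open>[n + 2]\<close> without neighbor alignments, either the last vertex is isolated or it
  closes an arc \<open>(i, n + 2)\<close>. In the second case delete both endpoints and close the gaps. Two arcs
  brought next to each other would be one ending at \<open>i - 1\<close> and one starting at \<open>i + 1\<close>, but the
  former is already aligned with \<open>(i, n + 2)\<close>; so the result is again free of neighbor alignments.
  Conversely, \<open>i\<close> may be reinserted at any of the \<open>n + 1\<close> places except directly after one of the
  \<open>k\<close> closers. Hence \<open>P(n + 2, k + 1) = P(n + 1, k + 1) + (n + 1 - k) P(n, k)\<close>. In terms of
  \<open>m = n - k\<close> this is the recurrence of the coefficients of \<open>(1 + z) (1 + 2 z) \<cdots> (1 + m z)\<close>, which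
  are therefore \<open>P(m + k, k)\<close>; substituting \<open>z = x y\<close> gives the identity.\<close>

section \<open>Matchings encoded by their arc sets, with isolated vertices implicit\<close>

definition NA_free_matching :: "nat \<Rightarrow> (nat \<times> nat) set \<Rightarrow> bool" where
  "NA_free_matching n M \<longleftrightarrow>
     (\<forall>(a, b)\<in>M. 1 \<le> a \<and> a < b \<and> b \<le> n) \<and>
     (\<forall>(a, b)\<in>M. \<forall>(c, d)\<in>M. (a, b) = (c, d) \<or> a \<noteq> c \<and> a \<noteq> d \<and> b \<noteq> c \<and> b \<noteq> d) \<and>
     (\<forall>(a, b)\<in>M. \<forall>(c, d)\<in>M. Suc b \<noteq> c)"

definition NA_free_matchings :: "nat \<Rightarrow> nat \<Rightarrow> (nat \<times> nat) set set" where
  "NA_free_matchings n k = {M. NA_free_matching n M \<and> card M = k}"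

lemma NA_free_matchingD:
  assumes "NA_free_matching n M"
  shows "(a, b) \<in> M \<Longrightarrow> 1 \<le> a" "(a, b) \<in> M \<Longrightarrow> a < b" "(a, b) \<in> M \<Longrightarrow> b \<le> n"
    and "(a, b) \<in> M \<Longrightarrow> (c, d) \<in> M \<Longrightarrow> (a, b) = (c, d) \<or> a \<noteq> c \<and> a \<noteq> d \<and> b \<noteq> c \<and> b \<noteq> d"
    and "(a, b) \<in> M \<Longrightarrow> (c, d) \<in> M \<Longrightarrow> Suc b \<noteq> c"
  using assms unfolding NA_free_matching_def by blast+

lemma NA_free_matchingI:
  assumes "\<And>a b. (a, b) \<in> M \<Longrightarrow> 1 \<le> a \<and> a < b \<and> b \<le> n"
    and "\<And>a b c d. (a, b) \<in> M \<Longrightarrow> (c, d) \<in> M \<Longrightarrow> (a, b) \<noteq> (c, d) \<Longrightarrow> a \<noteq> c \<and> a \<noteq> d \<and> b \<noteq> c \<and> b \<noteq> d"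
    and "\<And>a b c d. (a, b) \<in> M \<Longrightarrow> (c, d) \<in> M \<Longrightarrow> Suc b \<noteq> c"
  shows "NA_free_matching n M"
  using assms unfolding NA_free_matching_def by blast

lemma NA_free_matching_subset:
  "NA_free_matching n M \<Longrightarrow> M \<subseteq> {1..n} \<times> {1..n}"
  unfolding NA_free_matching_def by fastforce

lemma finite_NA_free_matching: "NA_free_matching n M \<Longrightarrow> finite M"
  by (rule finite_subset[OF NA_free_matching_subset]) simp_all

lemma finite_NA_free_matchings: "finite (NA_free_matchings n k)"
  by (rule finite_subset[of _ "Pow ({1..n} \<times> {1..n})"])
    (use NA_free_matching_subset in \<open>simp_all add: NA_free_matchings_def Collect_mono_iff Pow_def\<close>)

lemma inj_on_snd_NA_free_matching: "NA_free_matching n M \<Longrightarrow> inj_on snd M"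
  unfolding NA_free_matching_def inj_on_def by fastforce

lemma NA_free_matchings_0: "NA_free_matchings n 0 = {{}}"
  using finite_NA_free_matching by (auto simp: NA_free_matchings_def NA_free_matching_def)

lemma NA_free_matchings_Suc_eq_empty:
  assumes "n \<le> 1" shows "NA_free_matchings n (Suc k) = {}"
proof -
  have "M = {}" if "NA_free_matching n M" for M
    using NA_free_matchingD(1-3)[OF that] assms by fastforce
  then show ?thesis by (fastforce simp: NA_free_matchings_def)
qed

section \<open>Inserting and deleting the arc at the last vertex\<close>

definition skip :: "nat \<Rightarrow> nat \<Rightarrow> nat" where
  "skip i v = (if v < i then v else Suc v)"

lemma skip_less_iff [simp]: "skip i a < skip i b \<longleftrightarrow> a < b"
  and skip_eq_iff [simp]: "skip i a = skip i b \<longleftrightarrow> a = b"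
  and skip_neq [simp]: "skip i a \<noteq> i" "i \<noteq> skip i a"
  by (auto simp: skip_def)

lemma inj_map_prod_skip: "inj (map_prod (skip i) (skip i))"
  by (auto simp: inj_def)

lemma skip_cases:
  assumes "v \<noteq> i" obtains w where "v = skip i w"
proof (cases "v < i")
  case True then show ?thesis using that[of v] by (simp add: skip_def)
next
  case False then show ?thesis using that[of "v - 1"] assms by (simp add: skip_def)
qed

definition add_arc :: "nat \<Rightarrow> (nat \<times> nat) set \<times> nat \<Rightarrow> (nat \<times> nat) set" where
  "add_arc n = (\<lambda>(M, i). insert (i, n) (map_prod (skip i) (skip i) ` M))"

text \<open>An opener inserted at \<open>i\<close> pushes the vertices from \<open>i\<close> on one
  place to the right, while \<open>i - 1\<close> keeps its label and becomes the left neighbor.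
  Hence \<open>i\<close> is forbidden exactly when \<open>i - 1\<close> is a closer of
  \<open>M\<close>.\<close>

definition slots :: "nat \<Rightarrow> (nat \<times> nat) set \<Rightarrow> nat set" where
  "slots n M = {1..Suc n} - Suc ` snd ` M"

lemma skip_bounds:
  assumes "1 \<le> i" "i \<le> Suc n" "1 \<le> a" "a \<le> n"
  shows "1 \<le> skip i a" "skip i a \<le> Suc n"
  using assms by (auto simp: skip_def)

text \<open>Opening a gap creates no adjacency: \<open>Suc (skip i b) = skip i c\<close> forces
  \<open>Suc b = c\<close>. The new closer is the last vertex, so no opener follows it. The new
  opener directly follows an old closer only if \<open>Suc b = i\<close>, which the choice of slot
  excludes.\<close>

lemma NA_free_matching_add_arc:
  assumes M: "NA_free_matching n M" and i: "i \<in> slots n M"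
  shows "NA_free_matching (Suc (Suc n)) (add_arc (Suc (Suc n)) (M, i))"
proof -
  let ?s = "skip i"
  have i': "1 \<le> i" "i \<le> Suc n" and ic: "\<And>a b. (a, b) \<in> M \<Longrightarrow> Suc b \<noteq> i"
    using i by (force simp: slots_def)+
  have mem: "(a, b) \<in> add_arc (Suc (Suc n)) (M, i) \<longleftrightarrow>
      a = i \<and> b = Suc (Suc n) \<or> (\<exists>a' b'. (a', b') \<in> M \<and> a = ?s a' \<and> b = ?s b')" for a b
    by (force simp: add_arc_def)
  have bnd: "1 \<le> ?s a \<and> ?s a < ?s b \<and> ?s b \<le> Suc n" if "(a, b) \<in> M" for a b
    using NA_free_matchingD(1-3)[OF M that] skip_bounds[OF i', of a] skip_bounds[OF i', of b] by simp
  show ?thesis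
  proof (rule NA_free_matchingI)
    fix a b assume "(a, b) \<in> add_arc (Suc (Suc n)) (M, i)"
    then show "1 \<le> a \<and> a < b \<and> b \<le> Suc (Suc n)"
      unfolding mem using i' by (fastforce dest: bnd)
  next
    fix a b c d
    assume "(a, b) \<in> add_arc (Suc (Suc n)) (M, i)" "(c, d) \<in> add_arc (Suc (Suc n)) (M, i)"
      "(a, b) \<noteq> (c, d)"
    then show "a \<noteq> c \<and> a \<noteq> d \<and> b \<noteq> c \<and> b \<noteq> d"
      unfolding mem using i' by (auto dest: bnd NA_free_matchingD(4)[OF M])
  next
    fix a b c d
    assume *: "(a, b) \<in> add_arc (Suc (Suc n)) (M, i)" "(c, d) \<in> add_arc (Suc (Suc n)) (M, i)"
    show "Suc b \<noteq> c"
    proof (cases "b = Suc (Suc n)")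
      case True
      then show ?thesis using *(2) i' unfolding mem by (auto dest: bnd)
    next
      case False
      then obtain a' b' where ab: "(a', b') \<in> M" "b = ?s b'" using *(1) unfolding mem by auto
      from *(2) consider "c = i" | c' d' where "(c', d') \<in> M" "c = ?s c'" unfolding mem by auto
      then show ?thesis
      proof cases
        case 1
        then show ?thesis using ab ic[OF ab(1)] by (auto simp: skip_def split: if_splits)
      next
        case 2
        then show ?thesis using ab NA_free_matchingD(5)[OF M ab(1) 2(1)]
          by (auto simp: skip_def split: if_splits)
      qed
    qed
  qed
qed

lemma NA_free_matching_remove_arc:
  assumes M: "NA_free_matching (Suc (Suc n)) M" and i: "(i, Suc (Suc n)) \<in> M"
  obtains N where "NA_free_matching n N" "i \<in> slots n N" "M = add_arc (Suc (Suc n)) (N, i)"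
proof
  let ?s = "skip i"
  \<comment> \<open>Since \<open>i\<close> lies outside the range of \<open>skip i\<close>, the
    preimage drops the arc at \<open>i\<close> and closes the gap at once.\<close>
  let ?N = "map_prod ?s ?s -` M"
  note D = NA_free_matchingD[OF M]
  have i': "1 \<le> i" "i \<le> Suc n" using D(1-3)[OF i] by auto
  have mem: "(a, b) \<in> ?N \<longleftrightarrow> (?s a, ?s b) \<in> M" for a b by simp
  \<comment> \<open>Used twice: it makes \<open>i\<close> a slot of \<open>?N\<close>, and it rules
    out an alignment created by closing the gap, which would have \<open>Suc b = c = i\<close> in
    the new labels.\<close>
  have closer: "Suc b \<noteq> i" if "(a, b) \<in> ?N" for a b
  proof
    assume "Suc b = i"
    then have "Suc (?s b) = i" by (simp add: skip_def)
    then show False using D(5)[of "?s a" "?s b" i] i that by simp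
  qed
  show "NA_free_matching n ?N"
  proof (rule NA_free_matchingI; (unfold mem)?)
    fix a b assume ab: "(?s a, ?s b) \<in> M"
    \<comment> \<open>The last vertex belongs to the deleted arc alone. So \<open>?s b\<close> is at
      most \<open>Suc n\<close>, and as \<open>i\<close> is at most \<open>Suc n\<close> too, this
      leaves \<open>b\<close> at most \<open>n\<close>.\<close>
    have "?s b \<noteq> Suc (Suc n)" using D(4)[OF ab i] by auto
    then show "1 \<le> a \<and> a < b \<and> b \<le> n"
      using D(1-3)[OF ab] i' by (auto simp: skip_def split: if_splits)
  next
    fix a b c d assume "(?s a, ?s b) \<in> M" "(?s c, ?s d) \<in> M" "(a, b) \<noteq> (c, d)"
    then show "a \<noteq> c \<and> a \<noteq> d \<and> b \<noteq> c \<and> b \<noteq> d" using D(4) by fastforce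
  next
    fix a b c d assume ab: "(?s a, ?s b) \<in> M" and cd: "(?s c, ?s d) \<in> M"
    show "Suc b \<noteq> c"
      using D(5)[OF ab cd] closer[of a b] ab by (auto simp: skip_def split: if_splits)
  qed
  have "i \<notin> Suc ` snd ` K" if "\<And>a b. (a, b) \<in> K \<Longrightarrow> Suc b \<noteq> i" for K :: "(nat \<times> nat) set"
    using that by (metis imageE prod.collapse)
  from this[of ?N] closer have "i \<notin> Suc ` snd ` ?N" by blast
  then show "i \<in> slots n ?N" using i' by (simp add: slots_def)
  have "(a, b) \<in> map_prod ?s ?s ` ?N" if "(a, b) \<in> M" "(a, b) \<noteq> (i, Suc (Suc n))" for a b
  proof -
    have "a \<noteq> i" "b \<noteq> i" using D(4)[OF that(1) i] that(2) by auto
    then obtain a' b' where "a = ?s a'" "b = ?s b'" by (meson skip_cases)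
    then show ?thesis using that(1) by (auto intro!: image_eqI[of _ _ "(a', b')"])
  qed
  then show "M = add_arc (Suc (Suc n)) (?N, i)"
    using i by (auto simp: add_arc_def)
qed

lemma add_arc_last:
  assumes "NA_free_matching n M" "i \<in> slots n M" "(j, Suc (Suc n)) \<in> add_arc (Suc (Suc n)) (M, i)"
  shows "j = i"
  using NA_free_matchingD(4)[OF NA_free_matching_add_arc[OF assms(1,2)] assms(3), of i "Suc (Suc n)"]
  by (auto simp: add_arc_def)

text \<open>The slot is recovered as the partner of the last vertex (\<open>add_arc_last\<close>).
  Deleting that arc then leaves the image of \<open>M\<close> under an injective
  relabelling.\<close>

lemma inj_on_add_arc:
  "inj_on (add_arc (Suc (Suc n))) (SIGMA M : Collect (NA_free_matching n). slots n M)"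
proof (rule inj_onI, clarify)
  fix M i N j
  assume M: "NA_free_matching n M" "i \<in> slots n M" and N: "NA_free_matching n N" "j \<in> slots n N"
    and eq: "add_arc (Suc (Suc n)) (M, i) = add_arc (Suc (Suc n)) (N, j)"
  have ij: "j = i" using add_arc_last[OF M, of j] eq by (auto simp: add_arc_def)
  have "map_prod (skip i) (skip i) ` K = add_arc (Suc (Suc n)) (K, i) - {(i, Suc (Suc n))}" for K
    by (auto simp: add_arc_def)
  then have "map_prod (skip i) (skip i) ` M = map_prod (skip i) (skip i) ` N"
    using eq ij by simp
  then show "M = N \<and> i = j" using ij inj_image_eq_iff[OF inj_map_prod_skip] by blast
qed

section \<open>Counting insertions: the recurrence\<close>

lemma card_add_arc:
  assumes "NA_free_matching n M"
  shows "card (add_arc m (M, i)) = Suc (card M)"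
proof -
  have "(i, m) \<notin> map_prod (skip i) (skip i) ` M" by auto
  then show ?thesis
    using finite_NA_free_matching[OF assms] card_image[OF inj_on_subset[OF inj_map_prod_skip]]
    by (auto simp: add_arc_def)
qed

text \<open>Distinct arcs have distinct closers, all at most \<open>n\<close>, so each arc forbids
  its own position among the \<open>Suc n\<close> candidates.\<close>

lemma card_slots:
  assumes "NA_free_matching n M"
  shows "card (slots n M) = Suc n - card M"
proof -
  have "Suc ` snd ` M \<subseteq> {1..Suc n}" using NA_free_matchingD(3)[OF assms] by force
  moreover have "card (Suc ` snd ` M) = card M"
    by (simp add: card_image inj_on_snd_NA_free_matching[OF assms])
  ultimately show ?thesis
    by (simp add: slots_def card_Diff_subset finite_NA_free_matching[OF assms])
qed

text \<open>An arc satisfies \<open>a < b\<close>, so the last vertex can only be a closer; checking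
  second components suffices to see that it is isolated.\<close>

lemma NA_free_matching_Suc_iff:
  "NA_free_matching n M \<longleftrightarrow> NA_free_matching (Suc n) M \<and> Suc n \<notin> snd ` M"
proof -
  have "(\<forall>(a, b)\<in>M. 1 \<le> a \<and> a < b \<and> b \<le> n) \<longleftrightarrow>
      (\<forall>(a, b)\<in>M. 1 \<le> a \<and> a < b \<and> b \<le> Suc n) \<and> Suc n \<notin> snd ` M"
    by (force simp: le_Suc_eq)
  then show ?thesis unfolding NA_free_matching_def by (simp only: conj_ac)
qed

text \<open>Truncated subtraction does no harm: if \<open>k > Suc n\<close>, no matching of
  \<open>n\<close> vertices has \<open>k\<close> arcs and the product is zero anyway.\<close>

lemma card_NA_free_matchings_rec:
  "card (NA_free_matchings (Suc (Suc n)) (Suc k)) =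
     card (NA_free_matchings (Suc n) (Suc k)) + (Suc n - k) * card (NA_free_matchings n k)"
proof -
  let ?S = "SIGMA M : NA_free_matchings n k. slots n M"
  let ?I = "add_arc (Suc (Suc n)) ` ?S"
  have fin: "finite ?S"
    by (intro finite_SigmaI finite_NA_free_matchings) (simp add: slots_def)
  have split: "NA_free_matchings (Suc (Suc n)) (Suc k) = NA_free_matchings (Suc n) (Suc k) \<union> ?I"
  proof (intro equalityI subsetI)
    fix M assume "M \<in> NA_free_matchings (Suc (Suc n)) (Suc k)"
    then have M: "NA_free_matching (Suc (Suc n)) M" "card M = Suc k"
      by (auto simp: NA_free_matchings_def)
    show "M \<in> NA_free_matchings (Suc n) (Suc k) \<union> ?I"
    proof (cases "Suc (Suc n) \<in> snd ` M")
      case True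
      then obtain i where "(i, Suc (Suc n)) \<in> M" by auto
      then obtain N where N: "NA_free_matching n N" "i \<in> slots n N"
        "M = add_arc (Suc (Suc n)) (N, i)"
        using NA_free_matching_remove_arc[OF M(1)] by blast
      moreover have "card N = k" using card_add_arc[OF N(1)] N(3) M(2) by simp
      ultimately show ?thesis by (auto simp: NA_free_matchings_def)
    next
      case False
      then have "NA_free_matching (Suc n) M" using M(1) NA_free_matching_Suc_iff by blast
      then show ?thesis using M(2) by (simp add: NA_free_matchings_def)
    qed
  next
    fix M assume "M \<in> NA_free_matchings (Suc n) (Suc k) \<union> ?I"
    then show "M \<in> NA_free_matchings (Suc (Suc n)) (Suc k)"
      using NA_free_matching_Suc_iff[of "Suc n" M, THEN iffD1]
      by (auto simp: NA_free_matchings_def NA_free_matching_add_arc card_add_arc)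
  qed
  have disj: "NA_free_matchings (Suc n) (Suc k) \<inter> ?I = {}"
    using NA_free_matching_Suc_iff[of "Suc n", THEN iffD1]
    by (force simp: NA_free_matchings_def add_arc_def)
  have "inj_on (add_arc (Suc (Suc n))) ?S"
    by (rule inj_on_subset[OF inj_on_add_arc]) (auto simp: NA_free_matchings_def)
  then have "card ?I = card ?S" by (rule card_image)
  also have "\<dots> = (\<Sum>M\<in>NA_free_matchings n k. card (slots n M))"
    by (rule card_SigmaI) (auto simp: finite_NA_free_matchings slots_def)
  also have "\<dots> = (\<Sum>M\<in>NA_free_matchings n k. Suc n - k)"
    by (rule sum.cong) (auto simp: NA_free_matchings_def card_slots)
  finally have "card ?I = (Suc n - k) * card (NA_free_matchings n k)" by simp
  then show ?thesis
    unfolding split using disj fin by (simp add: card_Un_disjoint finite_NA_free_matchings)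
qed

section \<open>Partial matchings correspond to their arc sets\<close>

lemma partial_matching_arc_bounds:
  assumes "partial_matching n \<pi>" "(a, b) \<in> arcs \<pi>"
  shows "1 \<le> a" "a < b" "b \<le> n"
  using assms unfolding arcs_partial_matching[OF assms(1)]
  by (auto simp: partial_matching_def partition_on_def)

text \<open>The right-hand side depends on \<open>\<pi>\<close> only through
  \<open>arcs \<pi>\<close>; this yields injectivity of \<open>arcs\<close> on partial matchings of
  fixed \<open>n\<close>.\<close>

lemma partial_matching_eq_arcs:
  assumes \<pi>: "partial_matching n \<pi>"
  shows "\<pi> = (\<lambda>(a, b). {a, b}) ` arcs \<pi> \<union> (\<lambda>v. {v}) ` ({1..n} - fst ` arcs \<pi> - snd ` arcs \<pi>)"
    (is "_ = ?P \<union> ?S")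
proof (intro equalityI subsetI)
  note arcs = arcs_partial_matching[OF \<pi>]
  have un: "\<Union>\<pi> = {1..n}" and dj: "\<And>B C. B \<in> \<pi> \<Longrightarrow> C \<in> \<pi> \<Longrightarrow> B \<noteq> C \<Longrightarrow> B \<inter> C = {}"
    and ne: "{} \<notin> \<pi>" and c2: "\<And>B. B \<in> \<pi> \<Longrightarrow> card B \<le> 2"
    using \<pi> by (auto simp: partial_matching_def partition_on_def disjoint_def)
  {
    fix B assume B: "B \<in> \<pi>"
    have "finite B" using B un by (metis Union_upper finite_atLeastAtMost finite_subset)
    moreover have "B \<noteq> {}" using B ne by auto
    ultimately have "card B = 1 \<or> card B = 2" using c2[OF B] card_0_eq[of B] by linarith
    then show "B \<in> ?P \<union> ?S"
    proof
      assume "card B = 1"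
      then obtain v where v: "B = {v}" by (auto simp: card_1_singleton_iff)
      have "v \<noteq> a \<and> v \<noteq> b" if "(a, b) \<in> arcs \<pi>" for a b
        using that dj[OF B, of "{a, b}"] v by (auto simp: arcs)
      moreover have "v \<in> {1..n}" using un B v by auto
      ultimately have "v \<in> {1..n} - fst ` arcs \<pi> - snd ` arcs \<pi>" by fastforce
      then show ?thesis using v by simp
    next
      assume "card B = 2"
      then obtain a b where "B = {a, b}" "a < b"
        by (metis card_2_iff insert_commute linorder_neqE_nat)
      then show ?thesis using B by (force simp: arcs)
    qed
  }
  fix B assume "B \<in> ?P \<union> ?S"
  then show "B \<in> \<pi>"
  proof
    assume "B \<in> ?P" then show ?thesis by (auto simp: arcs)
  next
    assume "B \<in> ?S"
    then obtain v where v: "B = {v}" "v \<in> {1..n}" "\<And>w. (v, w) \<notin> arcs \<pi>" "\<And>w. (w, v) \<notin> arcs \<pi>"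
      by force
    obtain C where C: "C \<in> \<pi>" "v \<in> C" using un v(2) by blast
    have "w = v" if "w \<in> C" for w
    proof (rule ccontr)
      assume "w \<noteq> v"
      then have "card {v, w} = 2" by simp
      moreover have "finite C" using C un by (metis Union_upper finite_atLeastAtMost finite_subset)
      ultimately have "C = {v, w}" using card_seteq[of C "{v, w}"] c2[OF C(1)] C(2) that by simp
      then show False using v(3)[of w] v(4)[of w] C(1) \<open>w \<noteq> v\<close>
        by (auto simp: arcs insert_commute)
    qed
    then show ?thesis using C v(1) by (metis insertI1 singletonD subsetI subset_antisym)
  qed
qed

text \<open>Distinct arcs come from distinct, hence disjoint, blocks, so they share no endpoint. Of
  the inequalities in a neighbor alignment, two hold for any arcs and \<open>j1 < i2\<close> follows
  from \<open>j1 + 1 = i2\<close>, which leaves the condition on \<open>Suc b\<close>.\<close>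

lemma NA_free_matching_arcs:
  assumes \<pi>: "partial_matching n \<pi>"
  shows "NA_free_matching n (arcs \<pi>) \<longleftrightarrow> \<not> has_neighbor_alignment \<pi>"
proof
  assume "NA_free_matching n (arcs \<pi>)"
  then show "\<not> has_neighbor_alignment \<pi>"
    by (auto simp: has_neighbor_alignment_def neighbor_alignment_def dest: NA_free_matchingD(5))
next
  assume na: "\<not> has_neighbor_alignment \<pi>"
  note arcs = arcs_partial_matching[OF \<pi>]
  show "NA_free_matching n (arcs \<pi>)"
  proof (rule NA_free_matchingI)
    fix a b assume "(a, b) \<in> arcs \<pi>"
    then show "1 \<le> a \<and> a < b \<and> b \<le> n" using partial_matching_arc_bounds[OF \<pi>] by blast
  next
    fix a b c d assume ab: "(a, b) \<in> arcs \<pi>" and cd: "(c, d) \<in> arcs \<pi>" and ne: "(a, b) \<noteq> (c, d)"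
    have "a < b" "c < d" "{a, b} \<in> \<pi>" "{c, d} \<in> \<pi>" using ab cd by (auto simp: arcs)
    moreover from this have "{a, b} \<noteq> {c, d}" using ne by (auto simp: doubleton_eq_iff)
    ultimately have "{a, b} \<inter> {c, d} = {}"
      using \<pi> by (auto simp: partial_matching_def partition_on_def dest: disjointD)
    then show "a \<noteq> c \<and> a \<noteq> d \<and> b \<noteq> c \<and> b \<noteq> d" by auto
  next
    fix a b c d assume ab: "(a, b) \<in> arcs \<pi>" and cd: "(c, d) \<in> arcs \<pi>"
    have "a < b" "c < d" using ab cd by (auto simp: arcs)
    then show "Suc b \<noteq> c"
      using na ab cd by (fastforce simp: has_neighbor_alignment_def neighbor_alignment_def)
  qed
qed

lemma NA_free_matching_obtain:
  assumes M: "NA_free_matching n M"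
  obtains \<pi> where "partial_matching n \<pi>" "arcs \<pi> = M"
proof
  \<comment> \<open>The formula of \<open>partial_matching_eq_arcs\<close>, now read as a
    construction from \<open>M\<close>; it gives surjectivity of \<open>arcs\<close>.\<close>
  let ?\<pi> = "(\<lambda>(a, b). {a, b}) ` M \<union> (\<lambda>v. {v}) ` ({1..n} - fst ` M - snd ` M)"
  note D = NA_free_matchingD[OF M]
  have sing: "\<And>a b. (a, b) \<in> M \<Longrightarrow> a \<in> fst ` M \<and> b \<in> snd ` M" by force
  have "disjoint ?\<pi>"
  proof (rule disjointI)
    fix B C assume "B \<in> ?\<pi>" "C \<in> ?\<pi>" "B \<noteq> C"
    then show "B \<inter> C = {}" using D(4) sing by (fastforce simp: image_iff)
  qed
  moreover have "\<Union>?\<pi> = {1..n}"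
  proof (intro equalityI subsetI)
    fix v assume "v \<in> \<Union>?\<pi>"
    then show "v \<in> {1..n}" using D(1-3) by fastforce
  next
    fix v assume "v \<in> {1..n}"
    then show "v \<in> \<Union>?\<pi>" by (cases "v \<in> fst ` M \<or> v \<in> snd ` M") force+
  qed
  moreover have "{} \<notin> ?\<pi>" by auto
  moreover have "\<forall>B\<in>?\<pi>. card B \<le> 2" by (auto simp: card_insert_if)
  ultimately show pm: "partial_matching n ?\<pi>" by (auto simp: partial_matching_def partition_on_def)
  show "arcs ?\<pi> = M"
    unfolding arcs_partial_matching[OF pm] using D(2) by (fastforce simp: doubleton_eq_iff image_iff)
qed

lemma num_NA_free_eq_card: "num_NA_free n k = card (NA_free_matchings n k)"
  unfolding num_NA_free_def
proof (rule bij_betw_same_card[of arcs], rule bij_betw_imageI)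
  show "inj_on arcs {\<pi>. partial_matching n \<pi> \<and> card (arcs \<pi>) = k \<and> \<not> has_neighbor_alignment \<pi>}"
    by (rule inj_onI) (metis (no_types, lifting) mem_Collect_eq partial_matching_eq_arcs)
  show "arcs ` {\<pi>. partial_matching n \<pi> \<and> card (arcs \<pi>) = k \<and> \<not> has_neighbor_alignment \<pi>}
      = NA_free_matchings n k"
  proof (intro equalityI subsetI)
    fix M assume "M \<in> NA_free_matchings n k"
    then have M: "NA_free_matching n M" "card M = k" by (auto simp: NA_free_matchings_def)
    then obtain \<pi> where "partial_matching n \<pi>" "arcs \<pi> = M"
      using NA_free_matching_obtain by blast
    then show "M \<in> arcs ` {\<pi>. partial_matching n \<pi> \<and> card (arcs \<pi>) = k \<and> \<not> has_neighbor_alignment \<pi>}"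
      using M NA_free_matching_arcs by blast
  qed (auto simp: NA_free_matchings_def NA_free_matching_arcs)
qed

section \<open>Expansion of the product\<close>

lemma num_NA_free_0 [simp]: "num_NA_free n 0 = 1"
  by (simp add: num_NA_free_eq_card NA_free_matchings_0)

lemma num_NA_free_rec:
  "num_NA_free (Suc (Suc n)) (Suc k) = num_NA_free (Suc n) (Suc k) + (Suc n - k) * num_NA_free n k"
  by (simp add: num_NA_free_eq_card card_NA_free_matchings_rec)

text \<open>With \<open>k\<close> arcs there are \<open>2 * k\<close> endpoints. Here the recurrence
  replaces that count: \<open>m + 2 < 2 * (k' + 1)\<close> puts both of its terms in the vanishing
  range.\<close>

lemma num_NA_free_eq_0: "n < 2 * k \<Longrightarrow> num_NA_free n k = 0"
proof (induction n arbitrary: k rule: less_induct)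
  case (less n)
  then obtain k' where k: "k = Suc k'" by (cases k) auto
  show ?case
  proof (cases "n \<le> 1")
    case True
    then show ?thesis by (simp add: k num_NA_free_eq_card NA_free_matchings_Suc_eq_empty)
  next
    case False
    then obtain m where "n = Suc (Suc m)" by (auto simp: not_le less_iff_Suc_add)
    then show ?thesis using less k by (simp add: num_NA_free_rec)
  qed
qed

lemma prod_one_plus_eq_sum_num_NA_free:
  fixes z :: "'a :: comm_semiring_1"
  shows "(\<Prod>k = 1..n. 1 + of_nat k * z) = (\<Sum>k\<le>n. of_nat (num_NA_free (n + k) k) * z ^ k)"
proof (induction n)
  case (Suc n)
  let ?P = "\<lambda>n k. of_nat (num_NA_free n k) :: 'a"
  have "(\<Prod>k = 1..Suc n. 1 + of_nat k * z)
      = (\<Sum>k\<le>n. ?P (n + k) k * z ^ k) * (1 + of_nat (Suc n) * z)"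
    by (simp only: prod.nat_ivl_Suc' Suc.IH) (simp add: Suc.IH mult.commute)
  also have "\<dots> = (\<Sum>k\<le>n. ?P (n + k) k * z ^ k)
      + (\<Sum>k\<le>n. of_nat (Suc n) * ?P (n + k) k * z ^ Suc k)"
    by (simp only: distrib_left mult_1_right) (simp only: sum_distrib_left power_Suc mult_ac)
  \<comment> \<open>The term added at \<open>k = Suc n\<close> is zero, because
    \<open>2 * n + 1 < 2 * (n + 1)\<close>.\<close>
  also have "(\<Sum>k\<le>n. ?P (n + k) k * z ^ k) = (\<Sum>k\<le>Suc n. ?P (n + k) k * z ^ k)"
    by (simp add: num_NA_free_eq_0)
  also have "\<dots> = 1 + (\<Sum>k\<le>n. ?P (Suc (n + k)) (Suc k) * z ^ Suc k)"
    by (subst sum.atMost_Suc_shift) simp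
  \<comment> \<open>The recurrence at \<open>n + k\<close> vertices: its factor
    \<open>Suc (n + k) - k\<close> equals \<open>Suc n\<close> for every \<open>k\<close>, so it is
    the new factor of the product.\<close>
  also have "1 + (\<Sum>k\<le>n. ?P (Suc (n + k)) (Suc k) * z ^ Suc k)
        + (\<Sum>k\<le>n. of_nat (Suc n) * ?P (n + k) k * z ^ Suc k)
      = 1 + (\<Sum>k\<le>n. ?P (Suc (Suc (n + k))) (Suc k) * z ^ Suc k)"
    by (simp add: num_NA_free_rec sum.distrib distrib_right distrib_left add.assoc Suc_diff_le
        del: power_Suc)
  also have "\<dots> = (\<Sum>k\<le>Suc n. ?P (Suc n + k) k * z ^ k)"
    by (subst sum.atMost_Suc_shift) simp
  finally show ?case .
qed simp

section \<open>Infinite sums and comparison of coefficients\<close>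

lemma fps_has_sum_from_1:
  fixes f :: "nat \<Rightarrow> 'a :: comm_ring_1 fps"
  assumes "\<And>n i. i < n \<Longrightarrow> fps_nth (f n) i = 0"
  shows "(f has_sum Abs_fps (\<lambda>i. \<Sum>n = 1..i. fps_nth (f n) i)) {1..}"
  unfolding has_sum_def
proof (rule tendsto_fpsI)
  fix i
  show "\<forall>\<^sub>F F in finite_subsets_at_top {1..}.
      fps_nth (sum f F) i = fps_nth (Abs_fps (\<lambda>i. \<Sum>n = 1..i. fps_nth (f n) i)) i"
    unfolding eventually_finite_subsets_at_top
  \<comment> \<open>Terms with \<open>n > i\<close> contribute nothing to coefficient
    \<open>i\<close>, so it is constant once the finite index set contains
    \<open>{1..i}\<close>.\<close>
  proof (intro exI[of _ "{1..i}"] conjI allI impI)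
    fix F :: "nat set" assume F: "finite F \<and> {1..i} \<subseteq> F \<and> F \<subseteq> {1..}"
    have "(\<Sum>n\<in>F. fps_nth (f n) i) = (\<Sum>n = 1..i. fps_nth (f n) i)"
      using F by (intro sum.mono_neutral_right) (force intro!: assms)+
    then show "fps_nth (sum f F) i = fps_nth (Abs_fps (\<lambda>i. \<Sum>n = 1..i. fps_nth (f n) i)) i"
      by (simp add: fps_sum_nth)
  qed auto
qed

theorem theorem1p1:
  shows "(\<lambda>n. \<Sum>k = 0..n div 2. of_nat (num_NA_free n k) * var_x ^ n * var_y ^ k) summable_on {1..} \<and>
    (\<lambda>n. var_x ^ n * (\<Prod>k = 1..n. 1 + of_nat k * var_x * var_y)) summable_on {1..} \<and>
    (\<Sum>\<^sub>\<infinity>n\<in>{1..}. \<Sum>k = 0..n div 2. of_nat (num_NA_free n k) * var_x ^ n * var_y ^ k)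
      = (\<Sum>\<^sub>\<infinity>n\<in>{1..}. var_x ^ n * (\<Prod>k = 1..n. 1 + of_nat k * var_x * var_y))"
proof -
  let ?f = "\<lambda>n. \<Sum>k = 0..n div 2. of_nat (num_NA_free n k) * var_x ^ n * var_y ^ k"
  let ?g = "\<lambda>n. var_x ^ n * (\<Prod>k = 1..n. 1 + of_nat k * var_x * var_y)"
  let ?t = "\<lambda>n k. of_nat (num_NA_free n k) * fps_X ^ k :: int fps"
  have monomial: "fps_nth (of_nat c * var_x ^ n * var_y ^ k) i = (if i = n then of_nat c * fps_X ^ k else 0)"
    for c n k i
  proof -
    have "of_nat c * var_x ^ n * var_y ^ k = fps_const (of_nat c * fps_X ^ k) * var_x ^ n"
      by (simp add: fps_const_mult[symmetric] fps_of_nat fps_const_power mult_ac del: fps_const_mult)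
    then show ?thesis by simp
  qed
  have f: "fps_nth (?f n) i = (if i = n then \<Sum>k = 0..n div 2. ?t n k else 0)" for n i
    by (simp add: fps_sum_nth monomial)
  have g: "fps_nth (?g n) i = (if n \<le> i then ?t i (i - n) else 0)" for n i
  proof -
    have "?g n = var_x ^ n * (\<Sum>k\<le>n. of_nat (num_NA_free (n + k) k) * (var_x * var_y) ^ k)"
      using prod_one_plus_eq_sum_num_NA_free[of "var_x * var_y" n] by (simp only: mult.assoc)
    also have "\<dots> = (\<Sum>k\<le>n. of_nat (num_NA_free (n + k) k) * var_x ^ (n + k) * var_y ^ k)"
      by (simp add: sum_distrib_left power_mult_distrib power_add mult_ac)
    finally have "fps_nth (?g n) i = (\<Sum>k\<le>n. if i = n + k then ?t (n + k) k else 0)"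
      by (simp only: fps_sum_nth monomial)
    also have "\<dots> = (\<Sum>k\<le>n. if k = i - n then if n \<le> i then ?t i (i - n) else 0 else 0)"
      by (rule sum.cong) auto
    \<comment> \<open>The bound \<open>k \<le> n\<close> disappears: if \<open>i - n > n\<close>,
      then \<open>i < 2 * (i - n)\<close> and the number is zero.\<close>
    also have "\<dots> = (if n \<le> i then ?t i (i - n) else 0)"
      by (auto simp: sum.delta num_NA_free_eq_0)
    finally show ?thesis .
  qed
  \<comment> \<open>On the left only \<open>n = i\<close> contributes; on the right every
    \<open>n\<close> from 1 to \<open>i\<close> contributes the term with \<open>k = i - n\<close>.
    For \<open>i = 0\<close> both sums are empty.\<close>
  have coeffs: "(\<Sum>n = 1..i. fps_nth (?f n) i) = (\<Sum>n = 1..i. fps_nth (?g n) i)" for i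
  proof (cases "i = 0")
    case False
    have "(\<Sum>n = 1..i. fps_nth (?g n) i) = (\<Sum>n = 1..i. ?t i (i - n))"
      by (rule sum.cong[OF refl]) (simp only: g atLeastAtMost_iff if_True)
    also have "\<dots> = (\<Sum>k<i. ?t i k)"
      by (rule sum.reindex_bij_witness[of _ "\<lambda>k. i - k" "\<lambda>n. i - n"]) auto
    \<comment> \<open>As \<open>i\<close> is positive, \<open>i div 2 < i\<close>, so the range
      shrinks; the terms dropped have \<open>i < 2 * k\<close>.\<close>
    also have "\<dots> = (\<Sum>k = 0..i div 2. ?t i k)"
      using False by (intro sum.mono_neutral_right) (auto simp: num_NA_free_eq_0)
    also have "\<dots> = (\<Sum>n = 1..i. fps_nth (?f n) i)"
      using False by (simp only: f sum.delta finite_atLeastAtMost) simp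
    finally show ?thesis by simp
  qed simp
  have "(?f has_sum Abs_fps (\<lambda>i. \<Sum>n = 1..i. fps_nth (?f n) i)) {1..}"
    by (rule fps_has_sum_from_1) (subst f, simp)
  then have "(?f has_sum Abs_fps (\<lambda>i. \<Sum>n = 1..i. fps_nth (?g n) i)) {1..}"
    unfolding coeffs .
  moreover have "(?g has_sum Abs_fps (\<lambda>i. \<Sum>n = 1..i. fps_nth (?g n) i)) {1..}"
    by (rule fps_has_sum_from_1) (subst g, simp)
  ultimately show ?thesis
    by (metis (no_types, lifting) has_sum_imp_summable infsumI)
qed

end
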